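(* Let $M$ be the extended phase space with coordinates $(x,y,t)$, and let $(\mathbf{u},h,q)$ be a tuple consisting of a smooth velocity field $\mathbf{u}(x,y,t)=(u(x,y,t),v(x,y,t))$, a smooth positive scalar function $h(x,y,t)>0$, and a smooth scalar function $q(x,y,t)$ on $M$. Write $D_t:=\partial_t+u\,\partial_x+v\,\partial_y$. Suppose that $$D_t h+h\,(\nabla\cdot\mathbf{u})=0,\qquad D_t q=0$$ on $M$. Then the vector field (first-order differential operator) $L_q$ on $M$ defined by $$L_q f:=\frac{(\partial_y q,\,-\partial_x q)}{h}\cdot\nabla f=\frac{\partial_y q\,\partial_x f-\partial_x q\,\partial_y f}{h}$$ satisfies $[D_t,L_q]=0$. In particular, if $\nabla q\neq 0$ except possibly on a set of measure zero in $M$, then $(D_t,L_q,q)$ is an integrable system of type $(2,1)$ on $M$.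
   Context: All functions and vector fields are assumed smooth. The extended phase space $M$ is $\mathbb{R}^3$ with coordinates $(x,y,t)$, or the quotient obtained when some of these coordinates are taken to be periodic (each factor being $\mathbb{R}$ or a circle). The symbol $\nabla=(\partial_x,\partial_y)$ denotes the spatial gradient and $\nabla\cdot\mathbf{u}=\partial_x u+\partial_y v$. Vector fields are identified with first-order differential operators, and $[X,Y](f):=X(Y(f))-Y(X(f))$ for all smooth scalar functions $f$. Definition (integrable system of type $(p,r)$). Let $M$ be a manifold, $p\ge 1$, $r\ge 0$, $p+r=\dim M$. Vector fields $X_1,\dots,X_p$ and functions $F_1,\dots,F_r$ on $M$ form an integrable system $(X_1,\dots,X_p,F_1,\dots,F_r)$ of type $(p,r)$ if: (1) $[X_i,X_j]=0$ for all $i,j$; (2) $X_i(F_j)=0$ for all $i,j$; (3) $X_1,\dots,X_p$ are linearly independent at all points of $M$ except possibly on a set of measure zero; (4) the differentials (gradients on $M$) of $F_1,\dots,F_r$ are linearly independent at all points of $M$ except possibly on a set of measure zero. *)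

theory Defs
  imports "HOL-Analysis.Analysis"
begin

fun Ck :: "nat \<Rightarrow> (real ^ 'n \<Rightarrow> 'b::real_normed_vector) \<Rightarrow> bool" where
  "Ck 0 f \<longleftrightarrow> continuous_on UNIV f"
| "Ck (Suc k) f \<longleftrightarrow> (\<forall>p. f differentiable (at p)) \<and>
     (\<forall>w. Ck k (\<lambda>p. frechet_derivative f (at p) w))"

definition smooth :: "(real ^ 'n \<Rightarrow> 'b::real_normed_vector) \<Rightarrow> bool" where
  "smooth f \<longleftrightarrow> (\<forall>k. Ck k f)"

text \<open>
  A vector \<open>T\<close> encodes the manifold \<open>M\<close>, a product of lines and circles: coordinate \<open>i\<close> ranges
  over a circle of circumference \<open>\<bar>T $ i\<bar>\<close> if \<open>T $ i \<noteq> 0\<close>, and over the real line if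
  \<open>T $ i = 0\<close> (the periodicity condition is then void). Objects on \<open>M\<close> are represented by their
  lifts to the universal cover; for vector fields this uses the coordinate trivialisation of the
  tangent bundle. As the deck group is countable, a subset of \<open>M\<close> has measure zero iff its
  preimage in the cover is negligible.
\<close>

definition periodic :: "real ^ 'n \<Rightarrow> (real ^ 'n \<Rightarrow> 'b) \<Rightarrow> bool" where
  "periodic T f \<longleftrightarrow> (\<forall>p i. f (p + axis i (T $ i)) = f p)"

definition scalar_field :: "real ^ 'n \<Rightarrow> (real ^ 'n \<Rightarrow> real) \<Rightarrow> bool" where
  "scalar_field T f \<longleftrightarrow> smooth f \<and> periodic T f"

definition vector_field :: "real ^ 'n \<Rightarrow> (real ^ 'n \<Rightarrow> real ^ 'n) \<Rightarrow> bool" where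
  "vector_field T X \<longleftrightarrow> smooth X \<and> periodic T X"

definition partial :: "'n \<Rightarrow> (real ^ 'n \<Rightarrow> real) \<Rightarrow> real ^ 'n \<Rightarrow> real" where
  "partial i f p = frechet_derivative f (at p) (axis i 1)"

definition gradient :: "(real ^ 'n \<Rightarrow> real) \<Rightarrow> real ^ 'n \<Rightarrow> real ^ 'n" where
  "gradient f p = (\<chi> i. partial i f p)"

text \<open>The first-order differential operator identified with a vector field.\<close>

definition act :: "(real ^ 'n \<Rightarrow> real ^ 'n) \<Rightarrow> (real ^ 'n \<Rightarrow> real) \<Rightarrow> real ^ 'n \<Rightarrow> real"
    (infixr "\<rhd>" 75) where
  "(X \<rhd> f) p = (\<Sum>i\<in>UNIV. X p $ i * partial i f p)"

definition commutator ::
  "(real ^ 'n \<Rightarrow> real ^ 'n) \<Rightarrow> (real ^ 'n \<Rightarrow> real ^ 'n) \<Rightarrow> (real ^ 'n \<Rightarrow> real) \<Rightarrow> real ^ 'n \<Rightarrow> real" where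
  "commutator X Y f p = (X \<rhd> (Y \<rhd> f)) p - (Y \<rhd> (X \<rhd> f)) p"

definition commuting ::
  "real ^ 'n \<Rightarrow> (real ^ 'n \<Rightarrow> real ^ 'n) \<Rightarrow> (real ^ 'n \<Rightarrow> real ^ 'n) \<Rightarrow> bool" where
  "commuting T X Y \<longleftrightarrow> (\<forall>f. scalar_field T f \<longrightarrow> (\<forall>p. commutator X Y f p = 0))"

text \<open>Independence as a family: a repeated vector makes a list dependent.\<close>

definition lin_independent :: "(real ^ 'n) list \<Rightarrow> bool" where
  "lin_independent vs \<longleftrightarrow> distinct vs \<and> independent (set vs)"

definition integrable_system ::
  "real ^ 'n \<Rightarrow> nat \<Rightarrow> nat \<Rightarrow> (real ^ 'n \<Rightarrow> real ^ 'n) list \<Rightarrow> (real ^ 'n \<Rightarrow> real) list \<Rightarrow> bool" where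
  "integrable_system T p r Xs Fs \<longleftrightarrow>
     p \<ge> 1 \<and> p + r = CARD('n) \<and> length Xs = p \<and> length Fs = r \<and>
     (\<forall>X\<in>set Xs. vector_field T X) \<and> (\<forall>F\<in>set Fs. scalar_field T F) \<and>
     (\<forall>X\<in>set Xs. \<forall>Y\<in>set Xs. commuting T X Y) \<and>
     (\<forall>X\<in>set Xs. \<forall>F\<in>set Fs. \<forall>z. (X \<rhd> F) z = 0) \<and>
     negligible {z. \<not> lin_independent (map (\<lambda>X. X z) Xs)} \<and>
     negligible {z. \<not> lin_independent (map (\<lambda>F. gradient F z) Fs)}"

text \<open>On the extended phase space, the coordinates \<open>x, y, t\<close> are the components \<open>1, 2, 3\<close>.\<close>

abbreviation dx :: "(real ^ 3 \<Rightarrow> real) \<Rightarrow> real ^ 3 \<Rightarrow> real" where "dx \<equiv> partial 1"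
abbreviation dy :: "(real ^ 3 \<Rightarrow> real) \<Rightarrow> real ^ 3 \<Rightarrow> real" where "dy \<equiv> partial 2"
abbreviation dt :: "(real ^ 3 \<Rightarrow> real) \<Rightarrow> real ^ 3 \<Rightarrow> real" where "dt \<equiv> partial 3"

definition spatial_grad :: "(real ^ 3 \<Rightarrow> real) \<Rightarrow> real ^ 3 \<Rightarrow> real ^ 2" where
  "spatial_grad f p = vector [dx f p, dy f p]"

definition spatial_div :: "(real ^ 3 \<Rightarrow> real) \<Rightarrow> (real ^ 3 \<Rightarrow> real) \<Rightarrow> real ^ 3 \<Rightarrow> real" where
  "spatial_div u v p = dx u p + dy v p"

definition Dt :: "(real ^ 3 \<Rightarrow> real) \<Rightarrow> (real ^ 3 \<Rightarrow> real) \<Rightarrow> real ^ 3 \<Rightarrow> real ^ 3" where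
  "Dt u v p = vector [u p, v p, 1]"

definition Lq :: "(real ^ 3 \<Rightarrow> real) \<Rightarrow> (real ^ 3 \<Rightarrow> real) \<Rightarrow> real ^ 3 \<Rightarrow> real ^ 3" where
  "Lq h q p = vector [dy q p / h p, - dx q p / h p, 0]"

lemma Dt_act: "(Dt u v \<rhd> f) p = dt f p + u p * dx f p + v p * dy f p"
  by (simp add: act_def Dt_def sum_3 vector_3)

lemma Lq_act: "(Lq h q \<rhd> f) p = (dy q p * dx f p - dx q p * dy f p) / h p"
  by (simp add: act_def Lq_def sum_3 vector_3 diff_divide_distrib)

lemma Lq_act_inner:
  "(Lq h q \<rhd> f) p = (vector [dy q p, - dx q p] /\<^sub>R h p) \<bullet> spatial_grad f p"
  by (simp add: Lq_act spatial_grad_def inner_vec_def sum_2 vector_2 divide_inverse algebra_simps)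

end

theory Submission
  imports Defs
begin

text \<open>
  With \<open>g = 1/h\<close>, mass conservation reads \<open>D\<^sub>t g = g (\<nabla> \<cdot> u)\<close>. Differentiating \<open>D\<^sub>t q = 0\<close> in
  \<open>x\<close> and \<open>y\<close> expresses \<open>D\<^sub>t\<close> of the spatial derivatives of \<open>q\<close> through the first derivatives
  of \<open>u\<close>, \<open>v\<close> and \<open>q\<close>. Substituting both into \<open>[D\<^sub>t, L\<^sub>q] f\<close>, the second derivatives of
  \<open>f\<close> cancel by symmetry, and the stretching of \<open>\<nabla>q\<close> is compensated by the divergence from \<open>g\<close>.
\<close>

subsection \<open>Closure properties of smooth maps\<close>

lemma frechet_derivative_apply:
  "(f has_derivative f') (at p) \<Longrightarrow> frechet_derivative f (at p) w = f' w"
  by (metis frechet_derivative_at)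

text \<open>Product and quotient rules leave some factors undifferentiated; this lets those factors
  drop one order and fit the induction hypothesis. The base case is that differentiability implies
  continuity.\<close>

lemma Ck_Suc_imp_Ck: "Ck (Suc k) f \<Longrightarrow> Ck k f"
proof (induction k arbitrary: f)
  case 0
  then show ?case
    by (auto intro!: continuous_at_imp_continuous_on differentiable_imp_continuous_within)
next
  case (Suc k)
  from Suc.prems have "f differentiable (at p)"
    and "Ck (Suc k) (\<lambda>p. frechet_derivative f (at p) w)" for p w
    by (simp_all only: Ck.simps(2)[of "Suc k" f])
  then show ?case
    using Suc.IH by (simp only: Ck.simps(2)[of k f]) blast
qed

lemma Ck_const: "Ck k (\<lambda>p. c)"
  by (induction k arbitrary: c) simp_all

lemma Ck_add: "Ck k f \<Longrightarrow> Ck k g \<Longrightarrow> Ck k (\<lambda>p. f p + g p)"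
proof (induction k arbitrary: f g)
  case 0
  then show ?case by (simp add: continuous_on_add)
next
  case (Suc k)
  have "frechet_derivative (\<lambda>p. f p + g p) (at p) w
      = frechet_derivative f (at p) w + frechet_derivative g (at p) w" for p w
    using Suc.prems
    by (intro frechet_derivative_apply has_derivative_add) (simp_all add: frechet_derivative_works[THEN iffD1])
  then show ?case using Suc by simp
qed

lemma Ck_bounded_linear:
  assumes "bounded_linear L"
  shows "Ck k f \<Longrightarrow> Ck k (\<lambda>p. L (f p))"
proof (induction k arbitrary: f)
  case 0
  then show ?case using bounded_linear.continuous_on[OF assms] by simp
next
  case (Suc k)
  have D: "((\<lambda>p. L (f p)) has_derivative (\<lambda>w. L (frechet_derivative f (at p) w))) (at p)" for p
    using Suc.prems
    by (intro bounded_linear.has_derivative[OF assms]) (simp add: frechet_derivative_works[THEN iffD1])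
  then show ?case
    using Suc by (auto simp: frechet_derivative_apply[OF D] differentiable_def)
qed

text \<open>The induction keeps both factors arbitrary, because the product rule yields the new
  pairs \<open>f\<close> with a derivative of \<open>g\<close>, and vice versa.\<close>

lemma Ck_mult:
  fixes f g :: "real ^ 'n \<Rightarrow> real"
  shows "Ck k f \<Longrightarrow> Ck k g \<Longrightarrow> Ck k (\<lambda>p. f p * g p)"
proof (induction k arbitrary: f g)
  case 0
  then show ?case by (simp add: continuous_on_mult)
next
  case (Suc k)
  have D: "((\<lambda>p. f p * g p) has_derivative (\<lambda>w. f p * frechet_derivative g (at p) w
      + frechet_derivative f (at p) w * g p)) (at p)" for p
    using Suc.prems by (intro has_derivative_mult) (simp_all add: frechet_derivative_works[THEN iffD1])
  have "Ck k (\<lambda>p. f p * frechet_derivative g (at p) w + frechet_derivative f (at p) w * g p)" for w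
    using Suc Ck_Suc_imp_Ck[of k f] Ck_Suc_imp_Ck[of k g] by (intro Ck_add Suc.IH) simp_all
  then show ?case
    using D by (auto simp: frechet_derivative_apply[OF D] differentiable_def)
qed

text \<open>The derivative of \<open>1/f\<close> is a product of \<open>1/f\<close>, a derivative of
  \<open>f\<close> and \<open>1/f\<close>, so the induction hypothesis is only needed for the same
  \<open>f\<close>.\<close>

lemma Ck_inverse:
  fixes f :: "real ^ 'n \<Rightarrow> real"
  assumes "Ck k f" and nz: "\<And>p. f p \<noteq> 0"
  shows "Ck k (\<lambda>p. inverse (f p))"
  using assms(1)
proof (induction k)
  case 0
  then show ?case using nz by (simp add: continuous_on_inverse)
next
  case (Suc k)
  have D: "((\<lambda>p. inverse (f p)) has_derivative
      (\<lambda>w. - (inverse (f p) * frechet_derivative f (at p) w * inverse (f p)))) (at p)" for p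
    using Suc.prems nz by (intro Deriv.has_derivative_inverse) (simp_all add: frechet_derivative_works[THEN iffD1])
  have "Ck k (\<lambda>p. - (inverse (f p) * frechet_derivative f (at p) w * inverse (f p)))" for w
    using Suc Ck_Suc_imp_Ck[of k f]
    by (intro Ck_bounded_linear[OF bounded_linear_minus[OF bounded_linear_ident]] Ck_mult) simp_all
  then show ?case
    using D by (auto simp: frechet_derivative_apply[OF D] differentiable_def)
qed

lemma smooth_const: "smooth (\<lambda>p. c)"
  by (simp add: smooth_def Ck_const)

lemma smooth_add: "smooth f \<Longrightarrow> smooth g \<Longrightarrow> smooth (\<lambda>p. f p + g p)"
  by (simp add: smooth_def Ck_add)

lemma smooth_bounded_linear: "bounded_linear L \<Longrightarrow> smooth f \<Longrightarrow> smooth (\<lambda>p. L (f p))"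
  by (simp add: smooth_def Ck_bounded_linear)

lemma smooth_minus: "smooth f \<Longrightarrow> smooth (\<lambda>p. - f p)"
  by (rule smooth_bounded_linear[OF bounded_linear_minus[OF bounded_linear_ident]])

lemma smooth_diff: "smooth f \<Longrightarrow> smooth g \<Longrightarrow> smooth (\<lambda>p. f p - g p)"
  using smooth_add[of f "\<lambda>p. - g p"] smooth_minus[of g] by simp

lemma smooth_mult:
  fixes f g :: "real ^ 'n \<Rightarrow> real"
  shows "smooth f \<Longrightarrow> smooth g \<Longrightarrow> smooth (\<lambda>p. f p * g p)"
  by (simp add: smooth_def Ck_mult)

lemma smooth_inverse:
  fixes f :: "real ^ 'n \<Rightarrow> real"
  shows "smooth f \<Longrightarrow> (\<And>p. f p \<noteq> 0) \<Longrightarrow> smooth (\<lambda>p. inverse (f p))"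
  by (simp add: smooth_def Ck_inverse)

lemma smooth_frechet_derivative:
  "smooth f \<Longrightarrow> smooth (\<lambda>p. frechet_derivative f (at p) w)"
  unfolding smooth_def using Ck.simps(2) by blast

lemma smooth_partial: "smooth f \<Longrightarrow> smooth (partial i f)"
  using smooth_frechet_derivative[of f "axis i 1"] by (simp add: partial_def[abs_def])

lemma smooth_imp_differentiable: "smooth f \<Longrightarrow> f differentiable (at p)"
  unfolding smooth_def using Ck.simps(2) by blast

lemma smooth_imp_has_derivative:
  "smooth f \<Longrightarrow> (f has_derivative frechet_derivative f (at p)) (at p)"
  by (simp add: frechet_derivative_works[THEN iffD1] smooth_imp_differentiable)

lemma smooth_imp_isCont: "smooth f \<Longrightarrow> isCont f p"
  by (simp add: differentiable_imp_continuous_within smooth_imp_differentiable)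

text \<open>Expanding in the standard basis reduces the claim to sums of scalar functions times
  constant vectors, where scaling a fixed vector is bounded linear.\<close>

lemma smooth_vector_3:
  fixes a b c :: "real ^ 'n \<Rightarrow> real"
  assumes "smooth a" "smooth b" "smooth c"
  shows "smooth (\<lambda>p. vector [a p, b p, c p] :: real ^ 3)"
proof -
  have eq: "(vector [x, y, z] :: real ^ 3) = x *\<^sub>R axis 1 1 + y *\<^sub>R axis 2 1 + z *\<^sub>R axis 3 1"
    for x y z :: real
    by (simp add: vec_eq_iff forall_3 vector_3 axis_def)
  have "smooth (\<lambda>p. f p *\<^sub>R e)" if "smooth f" for f :: "real ^ 'n \<Rightarrow> real" and e :: "real ^ 3"
    using smooth_bounded_linear[OF bounded_linear_scaleR_left that] .
  then show ?thesis
    unfolding eq by (intro smooth_add) (auto simp: assms)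
qed

subsection \<open>Partial derivatives\<close>

lemma partial_const: "partial i (\<lambda>p. c) p = 0"
  by (simp add: partial_def)

lemma partial_add:
  assumes "smooth f" "smooth g"
  shows "partial i (\<lambda>p. f p + g p) p = partial i f p + partial i g p"
  unfolding partial_def
  by (intro frechet_derivative_apply has_derivative_add smooth_imp_has_derivative assms)

lemma partial_diff:
  assumes "smooth f" "smooth g"
  shows "partial i (\<lambda>p. f p - g p) p = partial i f p - partial i g p"
  unfolding partial_def
  by (intro frechet_derivative_apply has_derivative_diff smooth_imp_has_derivative assms)

lemma partial_mult:
  assumes "smooth f" "smooth g"
  shows "partial i (\<lambda>p. f p * g p) p = f p * partial i g p + partial i f p * g p"
  unfolding partial_def
  by (intro frechet_derivative_apply[where f' = "\<lambda>w. f p * frechet_derivative g (at p) w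
      + frechet_derivative f (at p) w * g p"] has_derivative_mult smooth_imp_has_derivative assms)

lemma partial_inverse:
  assumes "smooth f" "\<And>p. f p \<noteq> 0"
  shows "partial i (\<lambda>p. inverse (f p)) p = - (inverse (f p) * partial i f p * inverse (f p))"
  unfolding partial_def
  by (intro frechet_derivative_apply[where f' = "\<lambda>w. - (inverse (f p) *
      frechet_derivative f (at p) w * inverse (f p))"]
      Deriv.has_derivative_inverse smooth_imp_has_derivative assms)

section \<open>Symmetry of second derivatives\<close>

lemma smooth_has_real_derivative_line:
  fixes f :: "real ^ 'n \<Rightarrow> real"
  assumes "smooth f"
  shows "((\<lambda>s. f (c + s *\<^sub>R a)) has_real_derivative
    frechet_derivative f (at (c + s *\<^sub>R a)) a) (at s)"
proof -
  have "((\<lambda>s. c + s *\<^sub>R a) has_derivative (\<lambda>r. r *\<^sub>R a)) (at s)"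
    by (auto intro!: derivative_eq_intros)
  from has_derivative_compose[OF this smooth_imp_has_derivative[OF assms]]
  have "((\<lambda>s. f (c + s *\<^sub>R a)) has_derivative
      (\<lambda>r. frechet_derivative f (at (c + s *\<^sub>R a)) (r *\<^sub>R a))) (at s)" .
  moreover have "linear (frechet_derivative f (at (c + s *\<^sub>R a)))"
    by (simp add: assms linear_frechet_derivative smooth_imp_differentiable)
  ultimately show ?thesis
    by (simp add: has_field_derivative_def linear_scale mult.commute[of _ "frechet_derivative _ _ _"])
qed

text \<open>The left-hand side is symmetric in \<open>a\<close> and \<open>b\<close>; this is what makes second derivatives symmetric.\<close>

lemma second_difference_mvt:
  fixes f :: "real ^ 'n \<Rightarrow> real"
  assumes f: "smooth f" and s: "0 < s"
  obtains \<xi> \<eta> where "0 < \<xi>" "\<xi> < s" "0 < \<eta>" "\<eta> < s"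
    "f (p + s *\<^sub>R a + s *\<^sub>R b) - f (p + s *\<^sub>R a) - f (p + s *\<^sub>R b) + f p =
     s * s * frechet_derivative (\<lambda>z. frechet_derivative f (at z) a) (at (p + \<xi> *\<^sub>R a + \<eta> *\<^sub>R b)) b"
proof -
  let ?A = "\<lambda>z. frechet_derivative f (at z) a"
  \<comment> \<open>The first difference in direction \<open>b\<close>, viewed as a function of the
    displacement along \<open>a\<close>; the second difference is its increment from 0 to
    \<open>s\<close>.\<close>
  define \<phi> where "\<phi> r = f ((p + s *\<^sub>R b) + r *\<^sub>R a) - f (p + r *\<^sub>R a)" for r
  have "(\<phi> has_real_derivative ?A ((p + s *\<^sub>R b) + r *\<^sub>R a) - ?A (p + r *\<^sub>R a)) (at r)" for r
    unfolding \<phi>_def by (intro DERIV_diff smooth_has_real_derivative_line f)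
  then obtain \<xi> where \<xi>: "0 < \<xi>" "\<xi> < s"
    "\<phi> s - \<phi> 0 = (s - 0) * (?A ((p + s *\<^sub>R b) + \<xi> *\<^sub>R a) - ?A (p + \<xi> *\<^sub>R a))"
    using MVT2[OF s, of \<phi> "\<lambda>r. ?A ((p + s *\<^sub>R b) + r *\<^sub>R a) - ?A (p + r *\<^sub>R a)"] by blast
  \<comment> \<open>The mean value theorem along \<open>a\<close> has left a difference in direction
    \<open>b\<close> of the \<open>a\<close>-derivative; a second application along \<open>b\<close>
    turns it into a second derivative.\<close>
  have "((\<lambda>r. ?A ((p + \<xi> *\<^sub>R a) + r *\<^sub>R b)) has_real_derivative
      frechet_derivative ?A (at ((p + \<xi> *\<^sub>R a) + r *\<^sub>R b)) b) (at r)" for r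
    by (intro smooth_has_real_derivative_line smooth_frechet_derivative f)
  then obtain \<eta> where \<eta>: "0 < \<eta>" "\<eta> < s"
    "?A ((p + \<xi> *\<^sub>R a) + s *\<^sub>R b) - ?A ((p + \<xi> *\<^sub>R a) + 0 *\<^sub>R b) =
     (s - 0) * frechet_derivative ?A (at ((p + \<xi> *\<^sub>R a) + \<eta> *\<^sub>R b)) b"
    using MVT2[OF s, of "\<lambda>r. ?A ((p + \<xi> *\<^sub>R a) + r *\<^sub>R b)"
      "\<lambda>r. frechet_derivative ?A (at ((p + \<xi> *\<^sub>R a) + r *\<^sub>R b)) b"] by blast
  have "\<phi> s - \<phi> 0 = s * (s * frechet_derivative ?A (at ((p + \<xi> *\<^sub>R a) + \<eta> *\<^sub>R b)) b)"
    using \<xi>(3) \<eta>(3) by (simp add: algebra_simps)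
  then show thesis
    using that[of \<xi> \<eta>] \<xi> \<eta> by (simp add: \<phi>_def algebra_simps)
qed

text \<open>Both mixed derivatives are limits of one and the same difference quotient, so they agree
  by uniqueness of limits.\<close>

lemma smooth_second_derivative_symmetric:
  fixes f :: "real ^ 'n \<Rightarrow> real"
  assumes f: "smooth f"
  shows "frechet_derivative (\<lambda>z. frechet_derivative f (at z) a) (at p) b =
    frechet_derivative (\<lambda>z. frechet_derivative f (at z) b) (at p) a"
    (is "?F p = ?G p")
proof -
  define s where "s n = inverse (real (Suc n))" for n
  have s0: "0 < s n" for n by (simp add: s_def)
  have s_lim: "s \<longlonglongrightarrow> 0" unfolding s_def by (rule LIMSEQ_inverse_real_of_nat)
  let ?d = "\<lambda>n. (f (p + s n *\<^sub>R a + s n *\<^sub>R b) - f (p + s n *\<^sub>R a) - f (p + s n *\<^sub>R b) + f p)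
    / (s n * s n)"
  \<comment> \<open>The intermediate points are squeezed to \<open>p\<close> as the step size tends
    to 0, so continuity of \<open>H\<close> gives the limit. This serves both orders of
    differentiation.\<close>
  have lim: "?d \<longlonglongrightarrow> H p"
    if H: "isCont H p" and ex: "\<And>n. \<exists>\<xi> \<eta>. 0 < \<xi> \<and> \<xi> < s n \<and> 0 < \<eta> \<and> \<eta> < s n \<and>
      ?d n = H (p + \<xi> *\<^sub>R a + \<eta> *\<^sub>R b)" for H
  proof -
    obtain \<xi> \<eta> where *: "\<And>n. 0 < \<xi> n \<and> \<xi> n < s n \<and> 0 < \<eta> n \<and> \<eta> n < s n \<and>
      ?d n = H (p + \<xi> n *\<^sub>R a + \<eta> n *\<^sub>R b)" using ex by metis
    have "\<xi> \<longlonglongrightarrow> 0" "\<eta> \<longlonglongrightarrow> 0"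
      using * by (auto intro!: tendsto_sandwich[OF _ _ tendsto_const s_lim] always_eventually less_imp_le)
    then have "(\<lambda>n. p + \<xi> n *\<^sub>R a + \<eta> n *\<^sub>R b) \<longlonglongrightarrow> p + 0 *\<^sub>R a + 0 *\<^sub>R b"
      by (intro tendsto_intros)
    then have "(\<lambda>n. H (p + \<xi> n *\<^sub>R a + \<eta> n *\<^sub>R b)) \<longlonglongrightarrow> H p"
      using isCont_tendsto_compose[OF H] by simp
    then show ?thesis using * by simp
  qed
  have "?d \<longlonglongrightarrow> ?F p"
  proof (rule lim)
    show "isCont ?F p"
      by (intro smooth_imp_isCont smooth_frechet_derivative f)
    show "\<exists>\<xi> \<eta>. 0 < \<xi> \<and> \<xi> < s n \<and> 0 < \<eta> \<and> \<eta> < s n \<and> ?d n = ?F (p + \<xi> *\<^sub>R a + \<eta> *\<^sub>R b)" for n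
      using second_difference_mvt[OF f s0[of n], of p a b] s0[of n]
      by (metis (no_types, lifting) mult_pos_pos nonzero_mult_div_cancel_left less_irrefl)
  qed
  moreover have "?d \<longlonglongrightarrow> ?G p"
  proof (rule lim)
    show "isCont ?G p"
      by (intro smooth_imp_isCont smooth_frechet_derivative f)
    show "\<exists>\<xi> \<eta>. 0 < \<xi> \<and> \<xi> < s n \<and> 0 < \<eta> \<and> \<eta> < s n \<and> ?d n = ?G (p + \<xi> *\<^sub>R a + \<eta> *\<^sub>R b)" for n
    proof -
      \<comment> \<open>With \<open>a\<close> and \<open>b\<close> swapped, \<xi> measures the
        displacement along \<open>b\<close> and \<eta> that along \<open>a\<close>, so the two trade
        places as witnesses.\<close>
      obtain \<xi> \<eta> where *: "0 < \<xi>" "\<xi> < s n" "0 < \<eta>" "\<eta> < s n"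
        "f (p + s n *\<^sub>R b + s n *\<^sub>R a) - f (p + s n *\<^sub>R b) - f (p + s n *\<^sub>R a) + f p =
         s n * s n * ?G (p + \<xi> *\<^sub>R b + \<eta> *\<^sub>R a)"
        using second_difference_mvt[OF f s0[of n], of p b a] by metis
      then have "?d n = ?G (p + \<eta> *\<^sub>R a + \<xi> *\<^sub>R b)"
        using s0[of n] by (simp add: add_ac diff_diff_eq field_simps)
      with * show ?thesis by blast
    qed
  qed
  ultimately show ?thesis by (rule LIMSEQ_unique)
qed

lemma partial_commute:
  "smooth f \<Longrightarrow> partial i (partial j f) p = partial j (partial i f) p"
  using smooth_second_derivative_symmetric[of f "axis j 1" p "axis i 1"]
  by (simp add: partial_def[abs_def])

subsection \<open>Periodicity\<close>

text \<open>A translation has the identity as derivative, so by the chain rule the derivative of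
  \<open>f\<close> at the shifted point is also its derivative at \<open>p\<close>.\<close>

lemma periodic_partial:
  assumes "smooth f" "periodic T f"
  shows "periodic T (partial i f)"
  unfolding periodic_def
proof (intro allI)
  fix p j
  let ?c = "axis j (T $ j)"
  have "((\<lambda>z. z + ?c) has_derivative (\<lambda>w. w)) (at p)"
    by (auto intro!: derivative_eq_intros)
  from has_derivative_compose[OF this smooth_imp_has_derivative[OF assms(1)]]
  have "(f has_derivative frechet_derivative f (at (p + ?c))) (at p)"
    using assms(2) by (simp add: periodic_def)
  then show "partial i f (p + ?c) = partial i f p"
    by (simp add: partial_def frechet_derivative_apply)
qed

lemma vector_field_Dt:
  assumes "scalar_field T u" "scalar_field T v"
  shows "vector_field T (Dt u v)"
  using assms
  by (auto simp: vector_field_def scalar_field_def Dt_def[abs_def] periodic_def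
      intro!: smooth_vector_3 smooth_const)

lemma vector_field_Lq:
  assumes "scalar_field T h" "scalar_field T q" "\<And>p. h p \<noteq> 0"
  shows "vector_field T (Lq h q)"
proof -
  have "smooth (Lq h q)"
    unfolding Lq_def[abs_def] divide_inverse using assms
    by (auto simp: scalar_field_def
        intro!: smooth_vector_3 smooth_const smooth_mult smooth_minus smooth_inverse smooth_partial)
  then show ?thesis
    using assms periodic_partial[of q T 1] periodic_partial[of q T 2]
    by (simp add: vector_field_def scalar_field_def periodic_def Lq_def)
qed

subsection \<open>The commutator\<close>

lemma commutator_Dt_Lq:
  assumes u: "smooth u" and v: "smooth v" and h: "smooth h" and pos: "\<And>p. h p > 0"
    and q: "smooth q" and f: "smooth f"
    and mass: "\<And>p. (Dt u v \<rhd> h) p + h p * spatial_div u v p = 0"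
    and trans: "\<And>p. (Dt u v \<rhd> q) p = 0"
  shows "commutator (Dt u v) (Lq h q) f p = 0"
proof -
  \<comment> \<open>Division by \<open>h\<close> becomes multiplication by a smooth function, so
    only the product rule is needed in the commutator.\<close>
  define g where "g = (\<lambda>p. inverse (h p))"
  have nz: "h p \<noteq> 0" for p using pos[of p] by simp
  have g: "smooth g" unfolding g_def by (intro smooth_inverse h nz)
  note sm = u v g q f smooth_partial smooth_mult smooth_add smooth_diff
  note rules = partial_mult partial_add partial_diff sm
  \<comment> \<open>Equalities of functions are needed here, since the outer operator differentiates
    the result of the inner one.\<close>
  have Dt_fun: "(Dt u v \<rhd> w) = (\<lambda>p. dt w p + (u p * dx w p + v p * dy w p))" for w
    by (rule ext) (simp add: Dt_act)
  have Lq_fun: "(Lq h q \<rhd> w) = (\<lambda>p. (dy q p * dx w p - dx q p * dy w p) * g p)" for w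
    by (rule ext) (simp add: Lq_act g_def divide_inverse)
  \<comment> \<open>Mass conservation, solved for the time derivative of \<open>1/h\<close>, so that
    it can be eliminated by rewriting.\<close>
  have dtg: "dt g p = g p * (dx u p + dy v p) - u p * dx g p - v p * dy g p"
  proof -
    have "dt h p = - (u p * dx h p) - v p * dy h p - h p * (dx u p + dy v p)"
      using mass[of p] by (simp add: Dt_act spatial_div_def)
    then show ?thesis
      unfolding g_def partial_inverse[OF h nz] using nz[of p] by (simp add: field_simps)
  qed
  \<comment> \<open>Transport of \<open>q\<close> holds at every point, so the identity may be
    differentiated in any direction.\<close>
  have trans_i: "partial i (dt q) p + (u p * partial i (dx q) p + partial i u p * dx q p
      + (v p * partial i (dy q) p + partial i v p * dy q p)) = 0" for i
  proof -
    have "(Dt u v \<rhd> q) = (\<lambda>p. 0)"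
      using trans by (rule ext)
    then have "partial i (Dt u v \<rhd> q) p = 0"
      by (simp add: partial_const)
    then show ?thesis unfolding Dt_fun by (simp add: rules)
  qed
  \<comment> \<open>Oriented as rewrite rules, these move time derivatives innermost and put
    \<open>dx\<close> outside \<open>dy\<close>; mixed derivatives of \<open>q\<close> with time
    then match \<open>qtx\<close> and \<open>qty\<close>.\<close>
  note comm = partial_commute[OF q, of 3 1] partial_commute[OF q, of 3 2] partial_commute[OF q, of 2 1]
    partial_commute[OF f, of 3 1] partial_commute[OF f, of 3 2] partial_commute[OF f, of 2 1]
  have qtx: "dx (dt q) p = - (u p * dx (dx q) p + dx u p * dx q p
      + (v p * dx (dy q) p + dx v p * dy q p))"
    and qty: "dy (dt q) p = - (u p * dx (dy q) p + dy u p * dx q p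
      + (v p * dy (dy q) p + dy v p * dy q p))"
    using trans_i[of 1] trans_i[of 2] comm by (simp_all add: algebra_simps)
  show ?thesis
    unfolding commutator_def Dt_act Lq_act divide_inverse g_def[symmetric] Dt_fun Lq_fun
    \<comment> \<open>After the elimination of the time derivatives of \<open>g\<close> and of the
      spatial gradient of \<open>q\<close>, a polynomial identity in the remaining derivatives is
      left.\<close>
    by (simp add: rules comm qtx qty dtg) (simp add: algebra_simps)
qed

lemma commuting_refl: "commuting T X X"
  by (simp add: commuting_def commutator_def)

lemma commuting_sym: "commuting T X Y \<Longrightarrow> commuting T Y X"
  by (simp add: commuting_def commutator_def)

subsection \<open>Independence\<close>

lemma spatial_grad_eq_0_iff: "spatial_grad q p = 0 \<longleftrightarrow> dx q p = 0 \<and> dy q p = 0"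
  by (simp add: spatial_grad_def vec_eq_iff forall_2 vector_2)

text \<open>The time component, witnessed by index 3, is 1 for \<open>Dt\<close> and 0 for every
  multiple of \<open>Lq\<close>; hence only \<open>Lq\<close> being nonzero must come from the
  gradient.\<close>

lemma lin_independent_Dt_Lq:
  assumes "h p \<noteq> 0" "spatial_grad q p \<noteq> 0"
  shows "lin_independent [Dt u v p, Lq h q p]"
proof -
  have "Lq h q p \<noteq> 0"
    using assms unfolding spatial_grad_eq_0_iff
    by (auto simp: Lq_def vec_eq_iff[of "vector _"] forall_3 vector_3)
  moreover have "Dt u v p \<noteq> k *\<^sub>R Lq h q p" for k
    by (auto simp: Dt_def Lq_def vec_eq_iff vector_3 intro!: exI[of _ 3])
  ultimately have "independent {Dt u v p, Lq h q p}"
    by (simp add: independent_insert span_singleton image_iff)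
  moreover have "Dt u v p \<noteq> Lq h q p"
    by (auto simp: Dt_def Lq_def vec_eq_iff vector_3 intro!: exI[of _ 3])
  ultimately show ?thesis by (simp add: lin_independent_def)
qed

lemma lin_independent_gradient:
  assumes "spatial_grad q p \<noteq> 0"
  shows "lin_independent [gradient q p]"
proof -
  have "gradient q p \<noteq> 0"
    using assms unfolding spatial_grad_eq_0_iff by (metis gradient_def vec_lambda_beta zero_index)
  then show ?thesis by (simp add: lin_independent_def)
qed

theorem mainTheorem1:
  fixes T :: "real ^ 3" and u v h q :: "real ^ 3 \<Rightarrow> real"
  assumes "scalar_field T u" and "scalar_field T v"
    and "scalar_field T h" and "\<And>p. h p > 0"
    and "scalar_field T q"
    and "\<And>p. (Dt u v \<rhd> h) p + h p * spatial_div u v p = 0"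
    and "\<And>p. (Dt u v \<rhd> q) p = 0"
  shows "vector_field T (Lq h q) \<and> commuting T (Dt u v) (Lq h q) \<and>
    (negligible {p. spatial_grad q p = 0} \<longrightarrow>
       integrable_system T 2 1 [Dt u v, Lq h q] [q])"
proof (intro conjI impI)
  have nz: "h p \<noteq> 0" for p using assms(4)[of p] by simp
  show VL: "vector_field T (Lq h q)"
    by (rule vector_field_Lq[OF assms(3,5) nz])
  show C: "commuting T (Dt u v) (Lq h q)"
    using assms commutator_Dt_Lq[of u v h q] by (simp add: commuting_def scalar_field_def)
  assume N: "negligible {p. spatial_grad q p = 0}"
  \<comment> \<open>Dependence can occur only where the spatial gradient vanishes, and that set is
    negligible by assumption.\<close>
  have "negligible {z. \<not> lin_independent [Dt u v z, Lq h q z]}"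
    by (rule negligible_subset[OF N]) (use lin_independent_Dt_Lq nz in blast)
  moreover have "negligible {z. \<not> lin_independent [gradient q z]}"
    by (rule negligible_subset[OF N]) (use lin_independent_gradient in blast)
  \<comment> \<open>The bracket defining \<open>Lq\<close> is antisymmetric in \<open>q\<close> and
    the function acted on.\<close>
  moreover have "(Lq h q \<rhd> q) p = 0" for p
    by (simp add: Lq_act)
  ultimately show "integrable_system T 2 1 [Dt u v, Lq h q] [q]"
    using VL C assms(5,7) vector_field_Dt[OF assms(1,2)]
    by (simp add: integrable_system_def commuting_refl commuting_sym)
qed

end
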